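(* For every two finite simple graphs $G$ and $H$, $$\chi'_s(G\square H)\leq \min\{\chi'_s(G)\chi(H)+\chi'_s(H),\ \chi'_s(H)\chi(G)+\chi'_s(G)\}.$$ Moreover, this bound is tight: there exist graphs $G$ and $H$ for which equality holds.
   Context: All graphs are finite, simple and undirected. A star edge coloring of a graph $G$ is a proper edge coloring of $G$ such that no path or cycle of length four (i.e. with four edges) in $G$ is bi-colored (uses at most two colors). The star chromatic index $\chi'_s(G)$ is the smallest $k$ such that $G$ admits a star edge coloring with $k$ colors. $\chi(G)$ is the (vertex) chromatic number. The Cartesian product $G\square H$ has vertex set $V(G)\times V(H)$, with $(a,x)(b,y)$ an edge iff either $ab\in E(G)$ and $x=y$, or $xy\in E(H)$ and $a=b$. *)

theory Defs
  imports Main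
begin

record 'a ugraph =
  verts :: "'a set"
  edges :: "'a set set"

definition finite_simple_graph :: "'a ugraph \<Rightarrow> bool" where
  "finite_simple_graph G \<longleftrightarrow>
     finite (verts G) \<and> (\<forall>e\<in>edges G. e \<subseteq> verts G \<and> card e = 2)"

definition cartesian_product :: "'a ugraph \<Rightarrow> 'b ugraph \<Rightarrow> ('a \<times> 'b) ugraph"
    (infixl "\<box>" 70) where
  "G \<box> H = \<lparr>verts = verts G \<times> verts H,
            edges = {{(a, x), (b, y)} | a b x y.
              (a, x) \<in> verts G \<times> verts H \<and> (b, y) \<in> verts G \<times> verts H \<and>
              ({a, b} \<in> edges G \<and> x = y \<or> {x, y} \<in> edges H \<and> a = b)}\<rparr>"

fun walk_edges :: "'a list \<Rightarrow> 'a set list" where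
  "walk_edges (u # v # vs) = {u, v} # walk_edges (v # vs)"
| "walk_edges _ = []"

definition is_path :: "'a ugraph \<Rightarrow> 'a list \<Rightarrow> bool" where
  "is_path G vs \<longleftrightarrow>
     vs \<noteq> [] \<and> distinct vs \<and> set vs \<subseteq> verts G \<and> set (walk_edges vs) \<subseteq> edges G"

text \<open>A cycle is listed with its starting vertex repeated at the end.\<close>

definition is_cycle :: "'a ugraph \<Rightarrow> 'a list \<Rightarrow> bool" where
  "is_cycle G vs \<longleftrightarrow>
     length (walk_edges vs) \<ge> 3 \<and> hd vs = last vs \<and> distinct (tl vs) \<and>
     set vs \<subseteq> verts G \<and> set (walk_edges vs) \<subseteq> edges G"

definition proper_edge_coloring :: "'a ugraph \<Rightarrow> ('a set \<Rightarrow> 'c) \<Rightarrow> bool" where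
  "proper_edge_coloring G c \<longleftrightarrow>
     (\<forall>e\<in>edges G. \<forall>f\<in>edges G. e \<noteq> f \<and> e \<inter> f \<noteq> {} \<longrightarrow> c e \<noteq> c f)"

definition bicolored :: "('a set \<Rightarrow> 'c) \<Rightarrow> 'a list \<Rightarrow> bool" where
  "bicolored c vs \<longleftrightarrow> card (c ` set (walk_edges vs)) \<le> 2"

definition star_edge_coloring :: "'a ugraph \<Rightarrow> ('a set \<Rightarrow> 'c) \<Rightarrow> bool" where
  "star_edge_coloring G c \<longleftrightarrow>
     proper_edge_coloring G c \<and>
     (\<forall>vs. (is_path G vs \<or> is_cycle G vs) \<and> length (walk_edges vs) = 4 \<longrightarrow>
        \<not> bicolored c vs)"

definition star_chromatic_index :: "'a ugraph \<Rightarrow> nat" where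
  "star_chromatic_index G =
     (LEAST k. \<exists>c :: 'a set \<Rightarrow> nat. c ` edges G \<subseteq> {..<k} \<and> star_edge_coloring G c)"

definition proper_vertex_coloring :: "'a ugraph \<Rightarrow> ('a \<Rightarrow> 'c) \<Rightarrow> bool" where
  "proper_vertex_coloring G c \<longleftrightarrow>
     (\<forall>u\<in>verts G. \<forall>v\<in>verts G. {u, v} \<in> edges G \<longrightarrow> c u \<noteq> c v)"

definition chromatic_number :: "'a ugraph \<Rightarrow> nat" where
  "chromatic_number G =
     (LEAST k. \<exists>c :: 'a \<Rightarrow> nat. c ` verts G \<subseteq> {..<k} \<and> proper_vertex_coloring G c)"

lemma finite_edges:
  assumes "finite_simple_graph G"
  shows "finite (edges G)"
proof (rule finite_subset)
  show "edges G \<subseteq> Pow (verts G)" and "finite (Pow (verts G))"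
    using assms by (auto simp: finite_simple_graph_def)
qed

lemma finite_simple_graph_cartesian_product:
  assumes "finite_simple_graph G" "finite_simple_graph H"
  shows "finite_simple_graph (G \<box> H)"
proof -
  have "a \<noteq> b" if "{a, b} \<in> edges G" for a b
    using assms(1) that by (fastforce simp: finite_simple_graph_def)
  moreover have "x \<noteq> y" if "{x, y} \<in> edges H" for x y
    using assms(2) that by (fastforce simp: finite_simple_graph_def)
  ultimately show ?thesis
    using assms unfolding finite_simple_graph_def cartesian_product_def
    by (auto simp: card_insert_if)
qed

lemma length_walk_edges: "length (walk_edges vs) = length vs - 1"
  by (induction vs rule: walk_edges.induct) auto

text \<open>The sets of numbers minimised in \<^const>\<open>star_chromatic_index\<close> and
  \<^const>\<open>chromatic_number\<close> are nonempty for finite simple graphs, so both minima are attained.\<close>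

lemma card_walk_edges_4:
  assumes "is_path G vs \<or> is_cycle G vs" "length (walk_edges vs) = 4"
  shows "card (set (walk_edges vs)) = 4"
proof -
  from assms(2) have "length vs = 5" by (simp add: length_walk_edges)
  then obtain a b c d e where "vs = [a, b, c, d, e]"
    by (auto simp: eval_nat_numeral length_Suc_conv)
  then show ?thesis
    using assms by (auto simp: is_path_def is_cycle_def card_insert_if doubleton_eq_iff)
qed

lemma star_edge_coloring_exists:
  assumes "finite_simple_graph G"
  shows "\<exists>k. \<exists>c :: 'a set \<Rightarrow> nat. c ` edges (G :: 'a ugraph) \<subseteq> {..<k} \<and> star_edge_coloring G c"
proof -
  obtain c :: "'a set \<Rightarrow> nat" and k where c: "c ` edges G = {i. i < k}" "inj_on c (edges G)"
    using finite_imp_inj_to_nat_seg[OF finite_edges[OF assms]] by blast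
  have "\<not> bicolored c vs"
    if vs: "is_path G vs \<or> is_cycle G vs" "length (walk_edges vs) = 4" for vs
  proof -
    have "inj_on c (set (walk_edges vs))"
      using vs c(2) by (auto simp: is_path_def is_cycle_def intro: inj_on_subset)
    then show ?thesis
      using card_walk_edges_4[OF vs] by (simp add: bicolored_def card_image)
  qed
  then have "star_edge_coloring G c"
    using c(2) by (auto simp: star_edge_coloring_def proper_edge_coloring_def inj_on_def)
  with c(1) show ?thesis by (intro exI[of _ k] exI[of _ c]) auto
qed

lemma proper_vertex_coloring_exists:
  assumes "finite_simple_graph G"
  shows "\<exists>k. \<exists>c :: 'a \<Rightarrow> nat. c ` verts (G :: 'a ugraph) \<subseteq> {..<k} \<and> proper_vertex_coloring G c"
proof -
  have ne: "u \<noteq> v" if "{u, v} \<in> edges G" for u v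
    using assms that by (fastforce simp: finite_simple_graph_def)
  have fin: "finite (verts G)" using assms by (simp add: finite_simple_graph_def)
  obtain c :: "'a \<Rightarrow> nat" and k where c: "c ` verts G = {i. i < k}" "inj_on c (verts G)"
    using finite_imp_inj_to_nat_seg[OF fin] by blast
  have "proper_vertex_coloring G c"
    using c(2) ne by (auto simp: proper_vertex_coloring_def inj_on_def)
  with c(1) show ?thesis by (intro exI[of _ k] exI[of _ c]) auto
qed

end

theory Submission
  imports Defs
begin

text \<open>
  Let \<open>f\<close> be a proper vertex coloring of \<open>H\<close>. Give a \<open>G\<close>-edge of the layer over \<open>x\<close> the color of its
  projection paired with \<open>f x\<close>, and give an \<open>H\<close>-edge the color of its projection, using disjoint
  palettes. A bicolored walk of length four alternates its two colors. If both colors lie in the same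
  palette, the walk stays in one layer and projects to a bicolored walk in a factor. Otherwise it
  alternates between \<open>G\<close>-edges and \<open>H\<close>-edges, and the two \<open>G\<close>-edges, which have equal colors, lie
  over adjacent vertices of \<open>H\<close>, contradicting properness of \<open>f\<close>.
  Tightness: \<open>K\<^sub>2 \<box> K\<^sub>2\<close> is a 4-cycle, which needs three colors.
\<close>

section \<open>Properness and the star condition in terms of vertices\<close>

lemma simple_graph_edgeD:
  assumes "finite_simple_graph G" "{u, v} \<in> edges G"
  shows "u \<noteq> v" "u \<in> verts G" "v \<in> verts G"
  using assms by (fastforce simp: finite_simple_graph_def)+

lemma singleton_not_edge: "finite_simple_graph G \<Longrightarrow> {u} \<notin> edges G"
  using simple_graph_edgeD(1)[of G u u] by auto

lemma edge_doubletonE: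
  assumes "finite_simple_graph G" "e \<in> edges G"
  obtains u v where "e = {u, v}"
  using assms by (auto simp: finite_simple_graph_def card_2_iff)

text \<open>Any vertex common to two distinct edges serves as the middle \<open>v\<close> of a walk
  \<open>u\<close>, \<open>v\<close>, \<open>w\<close>; distinctness of the edges then becomes
  \<open>u \<noteq> w\<close>.\<close>

lemma proper_edge_coloring_iff:
  assumes "finite_simple_graph G"
  shows "proper_edge_coloring G c \<longleftrightarrow>
    (\<forall>u v w. {u, v} \<in> edges G \<and> {v, w} \<in> edges G \<and> u \<noteq> w \<longrightarrow> c {u, v} \<noteq> c {v, w})"
    (is "_ \<longleftrightarrow> ?R")
proof
  assume P: "proper_edge_coloring G c"
  show ?R
  proof (intro allI impI)
    fix u v w
    assume "{u, v} \<in> edges G \<and> {v, w} \<in> edges G \<and> u \<noteq> w"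
    moreover from this have "{u, v} \<noteq> {v, w}" by (auto simp: doubleton_eq_iff)
    ultimately show "c {u, v} \<noteq> c {v, w}"
      using P[unfolded proper_edge_coloring_def, rule_format, of "{u, v}" "{v, w}"] by simp
  qed
next
  assume R: ?R
  show "proper_edge_coloring G c"
    unfolding proper_edge_coloring_def
  proof (intro ballI impI)
    fix e g
    assume *: "e \<in> edges G" "g \<in> edges G" "e \<noteq> g \<and> e \<inter> g \<noteq> {}"
    then obtain v where v: "v \<in> e" "v \<in> g" by blast
    obtain u where u: "e = {u, v}"
      using edge_doubletonE[OF assms *(1)] v(1) by (auto simp: insert_commute)
    obtain w where w: "g = {v, w}"
      using edge_doubletonE[OF assms *(2)] v(2) by (auto simp: insert_commute)
    have "u \<noteq> w" using *(3) u w by (auto simp: insert_commute)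
    then show "c e \<noteq> c g" using R *(1,2) unfolding u w by blast
  qed
qed

text \<open>The end vertices \<open>u\<close> and \<open>y\<close> may coincide, which covers 4-cycles. All other coincidences among
  the five vertices are excluded by the three inequations and properness.\<close>

lemma star_edge_coloring_iff:
  assumes G: "finite_simple_graph G"
  shows "star_edge_coloring G c \<longleftrightarrow>
    (\<forall>u v w. {u, v} \<in> edges G \<and> {v, w} \<in> edges G \<and> u \<noteq> w \<longrightarrow> c {u, v} \<noteq> c {v, w}) \<and>
    (\<forall>u v w x y. {u, v} \<in> edges G \<and> {v, w} \<in> edges G \<and> {w, x} \<in> edges G \<and> {x, y} \<in> edges G \<and>
       u \<noteq> w \<and> v \<noteq> x \<and> w \<noteq> y \<longrightarrow> \<not> (c {u, v} = c {w, x} \<and> c {v, w} = c {x, y}))"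
    (is "_ \<longleftrightarrow> ?P \<and> ?S")
proof (intro iffI conjI)
  assume star: "star_edge_coloring G c"
  then show P: ?P by (simp add: star_edge_coloring_def proper_edge_coloring_iff[OF G])
  show ?S
  proof (intro allI impI notI)
    fix u v w x y
    assume *: "{u, v} \<in> edges G \<and> {v, w} \<in> edges G \<and> {w, x} \<in> edges G \<and> {x, y} \<in> edges G \<and>
        u \<noteq> w \<and> v \<noteq> x \<and> w \<noteq> y"
      and eq: "c {u, v} = c {w, x} \<and> c {v, w} = c {x, y}"
    have ne: "u \<noteq> v" "v \<noteq> w" "w \<noteq> x" "x \<noteq> y" and
      V: "u \<in> verts G" "v \<in> verts G" "w \<in> verts G" "x \<in> verts G" "y \<in> verts G"
      using * simple_graph_edgeD[OF G] by blast+
    \<comment> \<open>If \<open>u = x\<close>, the equally colored edges \<open>{u, v}\<close> and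
      \<open>{w, x}\<close> would be distinct and meet at \<open>u\<close>. Likewise
      \<open>v = y\<close> would make \<open>{v, w}\<close> and \<open>{x, y}\<close> meet at
      \<open>v\<close>.\<close>
    have "u \<noteq> x"
      using P[rule_format, of v u w] * eq ne by (auto simp: insert_commute)
    moreover have "v \<noteq> y"
      using P[rule_format, of w v x] * eq ne by (auto simp: insert_commute)
    ultimately have "is_path G [u, v, w, x, y] \<or> is_cycle G [u, v, w, x, y]"
      using * ne V by (auto simp: is_path_def is_cycle_def)
    then have "\<not> bicolored c [u, v, w, x, y]"
      using star by (simp add: star_edge_coloring_def)
    moreover have "bicolored c [u, v, w, x, y]"
      using eq by (simp add: bicolored_def card_insert_if)
    ultimately show False by contradiction
  qed
next
  assume PS: "?P \<and> ?S"
  show "star_edge_coloring G c"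
    unfolding star_edge_coloring_def
  proof (intro conjI allI impI)
    show "proper_edge_coloring G c" using PS by (simp add: proper_edge_coloring_iff[OF G])
    fix vs
    assume vs: "(is_path G vs \<or> is_cycle G vs) \<and> length (walk_edges vs) = 4"
    then have "length vs = 5" using length_walk_edges[of vs] by linarith
    then obtain u v w x y where uvs: "vs = [u, v, w, x, y]"
      by (auto simp: eval_nat_numeral length_Suc_conv)
    have E: "{u, v} \<in> edges G" "{v, w} \<in> edges G" "{w, x} \<in> edges G" "{x, y} \<in> edges G"
      "u \<noteq> w" "v \<noteq> x" "w \<noteq> y"
      using vs uvs by (auto simp: is_path_def is_cycle_def)
    have "c {u, v} \<noteq> c {v, w}" "c {v, w} \<noteq> c {w, x}" "c {w, x} \<noteq> c {x, y}"
      "\<not> (c {u, v} = c {w, x} \<and> c {v, w} = c {x, y})"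
      using PS E by blast+
    \<comment> \<open>Consecutive colors differ, so only two colors in total would force them to
      alternate, which the last inequation excludes.\<close>
    then have "card {c {u, v}, c {v, w}, c {w, x}, c {x, y}} \<ge> 3"
      by (auto simp: card_insert_if)
    then show "\<not> bicolored c vs" by (simp add: bicolored_def uvs)
  qed
qed

section \<open>Palettes and attained minima\<close>

text \<open>The star condition depends only on which edges have equal colors, and a map injective on
  the palette preserves this.\<close>

lemma star_edge_coloring_inj_comp:
  assumes G: "finite_simple_graph G" and c: "star_edge_coloring G c"
    and h: "inj_on h S" and S: "c ` edges G \<subseteq> S"
  shows "star_edge_coloring G (h \<circ> c)"
proof -
  have "h (c e) = h (c g) \<longleftrightarrow> c e = c g" if "e \<in> edges G" "g \<in> edges G" for e g
    using that S by (intro inj_on_eq_iff[OF h]) auto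
  then show ?thesis
    using c by (simp add: star_edge_coloring_iff[OF G] cong: imp_cong) blast
qed

text \<open>Allows palettes of any type, such as sums of products, although the index is defined by
  colors in an initial segment of the naturals.\<close>

lemma star_chromatic_index_le_card:
  assumes G: "finite_simple_graph G" and c: "star_edge_coloring G c"
    and S: "c ` edges G \<subseteq> S" "finite S"
  shows "star_chromatic_index G \<le> card S"
proof -
  obtain h where h: "bij_betw h S {..<card S}"
    using ex_bij_betw_finite_nat[OF S(2)] by (auto simp: atLeast0LessThan)
  have "star_edge_coloring G (h \<circ> c)"
    by (rule star_edge_coloring_inj_comp[OF G c bij_betw_imp_inj_on[OF h] S(1)])
  moreover have "(h \<circ> c) ` edges G \<subseteq> {..<card S}"
    using S(1) bij_betw_imp_surj_on[OF h] by auto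
  ultimately show ?thesis
    unfolding star_chromatic_index_def by (intro Least_le) blast
qed

lemma star_chromatic_index_attained:
  assumes "finite_simple_graph G"
  obtains c :: "'a set \<Rightarrow> nat"
  where "c ` edges (G :: 'a ugraph) \<subseteq> {..<star_chromatic_index G}" "star_edge_coloring G c"
  using LeastI_ex[OF star_edge_coloring_exists[OF assms]]
  unfolding star_chromatic_index_def by blast

lemma chromatic_number_attained:
  assumes "finite_simple_graph G"
  obtains f :: "'a \<Rightarrow> nat"
  where "f ` verts (G :: 'a ugraph) \<subseteq> {..<chromatic_number G}" "proper_vertex_coloring G f"
  using LeastI_ex[OF proper_vertex_coloring_exists[OF assms]]
  unfolding chromatic_number_def by blast

section \<open>The coloring of the product\<close>

text \<open>The defining condition is symmetric in the two ends, so it can be read off from either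
  order of \<open>p\<close> and \<open>q\<close>. Edges of a factor have their ends among its
  vertices, so only the constant coordinate carries a membership condition.\<close>

lemma edge_cartesian_product_iff:
  assumes "finite_simple_graph G" "finite_simple_graph H"
  shows "{p, q} \<in> edges (G \<box> H) \<longleftrightarrow>
    {fst p, fst q} \<in> edges G \<and> snd p = snd q \<and> snd p \<in> verts H \<or>
    {snd p, snd q} \<in> edges H \<and> fst p = fst q \<and> fst p \<in> verts G"
    (is "_ \<longleftrightarrow> ?R")
proof
  assume "{p, q} \<in> edges (G \<box> H)"
  then obtain a b x y where "{p, q} = {(a, x), (b, y)}" "(a, x) \<in> verts G \<times> verts H"
    "{a, b} \<in> edges G \<and> x = y \<or> {x, y} \<in> edges H \<and> a = b"
    by (auto simp: cartesian_product_def)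
  then show ?R by (auto simp: doubleton_eq_iff insert_commute)
next
  assume ?R
  then have "p \<in> verts G \<times> verts H \<and> q \<in> verts G \<times> verts H \<and>
      ({fst p, fst q} \<in> edges G \<and> snd p = snd q \<or> {snd p, snd q} \<in> edges H \<and> fst p = fst q)"
    using simple_graph_edgeD[OF assms(1)] simple_graph_edgeD[OF assms(2)]
    by (auto simp: mem_Times_iff)
  then show "{p, q} \<in> edges (G \<box> H)"
    unfolding cartesian_product_def by (cases p; cases q) auto
qed

text \<open>Projecting an edge of the product to \<open>G\<close> gives an edge for a \<open>G\<close>-edge and a singleton for an
  \<open>H\<close>-edge. For a \<open>G\<close>-edge, \<open>snd ` e\<close> is the singleton of its layer.\<close>

definition product_coloring ::
  "'a ugraph \<Rightarrow> ('a set \<Rightarrow> 'c) \<Rightarrow> ('b set \<Rightarrow> 'd) \<Rightarrow> ('b \<Rightarrow> 'e) \<Rightarrow> ('a \<times> 'b) set \<Rightarrow> 'c \<times> 'e + 'd" where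
  "product_coloring G cG cH f e =
     (if fst ` e \<in> edges G then Inl (cG (fst ` e), f (the_elem (snd ` e))) else Inr (cH (snd ` e)))"

lemma product_coloring_left:
  "{fst p, fst q} \<in> edges G \<Longrightarrow> snd p = snd q \<Longrightarrow>
    product_coloring G cG cH f {p, q} = Inl (cG {fst p, fst q}, f (snd q))"
  by (simp add: product_coloring_def)

lemma product_coloring_right:
  "finite_simple_graph G \<Longrightarrow> fst p = fst q \<Longrightarrow>
    product_coloring G cG cH f {p, q} = Inr (cH {snd p, snd q})"
  by (simp add: product_coloring_def singleton_not_edge)

lemma star_edge_coloring_product_coloring:
  assumes G: "finite_simple_graph G" and H: "finite_simple_graph H"
    and cG: "star_edge_coloring G cG" and cH: "star_edge_coloring H cH"
    and f: "proper_vertex_coloring H f"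
  shows "star_edge_coloring (G \<box> H) (product_coloring G cG cH f)"
    (is "star_edge_coloring _ ?c")
proof -
  let ?L = "\<lambda>p q. {fst p, fst q} \<in> edges G \<and> snd p = snd q"
  let ?R = "\<lambda>p q. {snd p, snd q} \<in> edges H \<and> fst p = fst q"
  have edge: "?L p q \<or> ?R p q" if "{p, q} \<in> edges (G \<box> H)" for p q
    using that edge_cartesian_product_iff[OF G H] by blast
  have L: "?c {p, q} = Inl (cG {fst p, fst q}, f (snd q))" if "?L p q" for p q
    using that product_coloring_left by blast
  have R: "?c {p, q} = Inr (cH {snd p, snd q})" if "?R p q" for p q
    using that product_coloring_right[OF G] by blast
  \<comment> \<open>The summand of a color reveals the kind of its edge.\<close>
  have same: "?L p q \<and> ?L r s \<or> ?R p q \<and> ?R r s"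
    if "{p, q} \<in> edges (G \<box> H)" "{r, s} \<in> edges (G \<box> H)" "?c {p, q} = ?c {r, s}" for p q r s
    using edge[OF that(1)] edge[OF that(2)] that(3) L R by (metis Inl_Inr_False)
  \<comment> \<open>The second components of the colors give \<open>f (snd q) = f (snd s)\<close>,
    and \<open>snd s = snd r\<close> is adjacent to \<open>snd q\<close> in
    \<open>H\<close>.\<close>
  have layer: False if "?L p q" "?L r s" "?R q r" "?c {p, q} = ?c {r, s}" for p q r s
    using f that L[OF that(1)] L[OF that(2)] simple_graph_edgeD[OF H, of "snd q" "snd r"]
    by (auto simp: proper_vertex_coloring_def)
  note sG = cG[unfolded star_edge_coloring_iff[OF G]]
  note sH = cH[unfolded star_edge_coloring_iff[OF H]]
  show ?thesis
    unfolding star_edge_coloring_iff[OF finite_simple_graph_cartesian_product[OF G H]]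
  proof (intro conjI allI impI)
    fix p q r
    assume *: "{p, q} \<in> edges (G \<box> H) \<and> {q, r} \<in> edges (G \<box> H) \<and> p \<noteq> r"
    show "?c {p, q} \<noteq> ?c {q, r}"
    proof
      assume eq: "?c {p, q} = ?c {q, r}"
      consider "?L p q" "?L q r" | "?R p q" "?R q r" using same[OF _ _ eq] * by blast
      then show False
      proof cases
        case 1
        \<comment> \<open>Both edges lie in one layer, so \<open>p\<close> and \<open>r\<close> can
          differ only in the first coordinate.\<close>
        then have "fst p \<noteq> fst r" using * by (simp add: prod_eq_iff)
        then show False using sG 1 eq L[OF 1(1)] L[OF 1(2)] by auto
      next
        case 2
        then have "snd p \<noteq> snd r" using * by (simp add: prod_eq_iff)
        then show False using sH 2 eq R[OF 2(1)] R[OF 2(2)] by auto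
      qed
    qed
  next
    fix p q r s t
    assume *: "{p, q} \<in> edges (G \<box> H) \<and> {q, r} \<in> edges (G \<box> H) \<and> {r, s} \<in> edges (G \<box> H) \<and>
      {s, t} \<in> edges (G \<box> H) \<and> p \<noteq> r \<and> q \<noteq> s \<and> r \<noteq> t"
    show "\<not> (?c {p, q} = ?c {r, s} \<and> ?c {q, r} = ?c {s, t})"
    proof
      assume eq: "?c {p, q} = ?c {r, s} \<and> ?c {q, r} = ?c {s, t}"
      have "?L p q \<and> ?L r s \<or> ?R p q \<and> ?R r s" "?L q r \<and> ?L s t \<or> ?R q r \<and> ?R s t"
        using same * eq by blast+
      \<comment> \<open>In the two mixed cases, a pair of equally colored \<open>G\<close>-edges
        encloses an \<open>H\<close>-edge: the first and third edges of the walk, or the second and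
        fourth. Either way \<open>layer\<close> applies.\<close>
      then consider "?L p q" "?L r s" "?L q r" "?L s t" | "?R p q" "?R r s" "?R q r" "?R s t"
        | "?L p q" "?L r s" "?R q r" | "?L q r" "?L s t" "?R r s" by blast
      then show False
      proof cases
        case 1
        then have "fst p \<noteq> fst r" "fst q \<noteq> fst s" "fst r \<noteq> fst t"
          using * by (simp_all add: prod_eq_iff)
        moreover have "cG {fst p, fst q} = cG {fst r, fst s}" "cG {fst q, fst r} = cG {fst s, fst t}"
          using eq L[OF 1(1)] L[OF 1(2)] L[OF 1(3)] L[OF 1(4)] by simp_all
        ultimately show False using sG 1 by blast
      next
        case 2
        then have "snd p \<noteq> snd r" "snd q \<noteq> snd s" "snd r \<noteq> snd t"
          using * by (simp_all add: prod_eq_iff)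
        moreover have "cH {snd p, snd q} = cH {snd r, snd s}" "cH {snd q, snd r} = cH {snd s, snd t}"
          using eq R[OF 2(1)] R[OF 2(2)] R[OF 2(3)] R[OF 2(4)] by simp_all
        ultimately show False using sH 2 by blast
      next
        case 3
        then show False using layer eq by blast
      next
        case 4
        then show False using layer eq by blast
      qed
    qed
  qed
qed

section \<open>The upper bound and its symmetric form\<close>

lemma star_chromatic_index_cartesian_product_le:
  assumes G: "finite_simple_graph G" and H: "finite_simple_graph H"
  shows "star_chromatic_index (G \<box> H)
    \<le> star_chromatic_index G * chromatic_number H + star_chromatic_index H"
proof -
  obtain cG where cG: "cG ` edges G \<subseteq> {..<star_chromatic_index G}" "star_edge_coloring G cG"
    using star_chromatic_index_attained[OF G] .
  obtain cH where cH: "cH ` edges H \<subseteq> {..<star_chromatic_index H}" "star_edge_coloring H cH"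
    using star_chromatic_index_attained[OF H] .
  obtain f where f: "f ` verts H \<subseteq> {..<chromatic_number H}" "proper_vertex_coloring H f"
    using chromatic_number_attained[OF H] .
  \<comment> \<open>The cardinality of this palette is the right-hand side of the bound.\<close>
  let ?S = "({..<star_chromatic_index G} \<times> {..<chromatic_number H}) <+> {..<star_chromatic_index H}"
  note GH = finite_simple_graph_cartesian_product[OF G H]
  have "product_coloring G cG cH f e \<in> ?S" if e: "e \<in> edges (G \<box> H)" for e
  proof -
    obtain p q where pq: "e = {p, q}" using edge_doubletonE[OF GH e] .
    then consider "{fst p, fst q} \<in> edges G" "snd p = snd q" "snd p \<in> verts H"
      | "{snd p, snd q} \<in> edges H" "fst p = fst q"
      using e edge_cartesian_product_iff[OF G H] by blast
    then show ?thesis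
    proof cases
      case 1
      then show ?thesis
        using cG(1) f(1) by (auto simp: pq product_coloring_left)
    next
      case 2
      then show ?thesis
        using cH(1) by (auto simp: pq product_coloring_right[OF G])
    qed
  qed
  then have "product_coloring G cG cH f ` edges (G \<box> H) \<subseteq> ?S" by blast
  from star_chromatic_index_le_card[OF GH
      star_edge_coloring_product_coloring[OF G H cG(2) cH(2) f(2)] this]
  show ?thesis by (simp add: card_Plus card_cartesian_product)
qed

text \<open>Swapping coordinates is an isomorphism of the two products, along which colorings are
  pulled back. This turns the bound for \<open>H \<box> G\<close> into the second argument of the
  minimum.\<close>

lemma star_chromatic_index_cartesian_product_commute_le:
  assumes G: "finite_simple_graph G" and H: "finite_simple_graph H"
  shows "star_chromatic_index (G \<box> H) \<le> star_chromatic_index (H \<box> G)"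
proof -
  note GH = finite_simple_graph_cartesian_product[OF G H]
  note HG = finite_simple_graph_cartesian_product[OF H G]
  obtain c where c: "c ` edges (H \<box> G) \<subseteq> {..<star_chromatic_index (H \<box> G)}"
    "star_edge_coloring (H \<box> G) c"
    using star_chromatic_index_attained[OF HG] .
  note star = c(2)[unfolded star_edge_coloring_iff[OF HG]]
  have sw: "{p, q} \<in> edges (G \<box> H) \<longleftrightarrow> {prod.swap p, prod.swap q} \<in> edges (H \<box> G)" for p q
    by (auto simp: edge_cartesian_product_iff[OF G H] edge_cartesian_product_iff[OF H G])
  have inj: "p \<noteq> q \<longleftrightarrow> prod.swap p \<noteq> prod.swap q" for p q :: "'a \<times> 'b"
    by (auto simp: prod_eq_iff)
  \<comment> \<open>Once edges and inequations are rewritten to swapped vertices, each goal is an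
    instance of \<open>star\<close>.\<close>
  have "star_edge_coloring (G \<box> H) (\<lambda>e. c (prod.swap ` e))"
    unfolding star_edge_coloring_iff[OF GH] sw inj image_insert image_empty
    by (intro conjI allI impI; (rule star[THEN conjunct1, rule_format] |
          rule star[THEN conjunct2, rule_format]); assumption)
  moreover have "prod.swap ` e \<in> edges (H \<box> G)" if e: "e \<in> edges (G \<box> H)" for e
  proof -
    obtain p q where "e = {p, q}" using edge_doubletonE[OF GH e] .
    then show ?thesis using e sw[of p q] by simp
  qed
  then have "(\<lambda>e. c (prod.swap ` e)) ` edges (G \<box> H) \<subseteq> {..<star_chromatic_index (H \<box> G)}"
    using c(1) by blast
  ultimately have "star_chromatic_index (G \<box> H) \<le> card {..<star_chromatic_index (H \<box> G)}"
    by (rule star_chromatic_index_le_card[OF GH _ _ finite_lessThan])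
  then show ?thesis by simp
qed

section \<open>Tightness\<close>

lemma star_chromatic_index_ge_3_if_4_cycle:
  assumes G: "finite_simple_graph G" and cyc: "is_cycle G vs" "length (walk_edges vs) = 4"
  shows "3 \<le> star_chromatic_index G"
proof -
  obtain c where c: "c ` edges G \<subseteq> {..<star_chromatic_index G}" "star_edge_coloring G c"
    using star_chromatic_index_attained[OF G] .
  have "2 < card (c ` set (walk_edges vs))"
    using c(2) cyc by (auto simp: star_edge_coloring_def bicolored_def not_le)
  also have "c ` set (walk_edges vs) \<subseteq> {..<star_chromatic_index G}"
    using c(1) cyc(1) by (auto simp: is_cycle_def)
  then have "card (c ` set (walk_edges vs)) \<le> star_chromatic_index G"
    using card_mono[OF finite_lessThan] by fastforce
  finally show ?thesis by simp
qed

definition K2 :: "nat ugraph" where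
  "K2 = \<lparr>verts = {0, 1}, edges = {{0, 1}}\<rparr>"

lemma finite_simple_graph_K2: "finite_simple_graph K2"
  by (simp add: finite_simple_graph_def K2_def)

text \<open>A single edge has no other edge to meet, so a constant coloring satisfies all conditions
  vacuously.\<close>

lemma star_chromatic_index_K2_le: "star_chromatic_index K2 \<le> 1"
proof -
  have "star_edge_coloring K2 (\<lambda>_. 0 :: nat)"
    unfolding star_edge_coloring_iff[OF finite_simple_graph_K2]
    by (auto simp: K2_def doubleton_eq_iff)
  from star_chromatic_index_le_card[OF finite_simple_graph_K2 this, of "{0}"]
  show ?thesis by auto
qed

lemma chromatic_number_K2_le: "chromatic_number K2 \<le> 2"
  unfolding chromatic_number_def
  by (intro Least_le exI[of _ "\<lambda>n. n"])
    (auto simp: proper_vertex_coloring_def K2_def doubleton_eq_iff)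

lemma star_chromatic_index_K2_box_K2_ge: "3 \<le> star_chromatic_index (K2 \<box> K2)"
proof (rule star_chromatic_index_ge_3_if_4_cycle)
  show "is_cycle (K2 \<box> K2) [(0, 0), (0, 1), (1, 1), (1, 0), (0, 0)]"
    using edge_cartesian_product_iff[OF finite_simple_graph_K2 finite_simple_graph_K2]
    by (simp add: is_cycle_def) (simp add: cartesian_product_def K2_def insert_commute)
qed (simp_all add: finite_simple_graph_cartesian_product finite_simple_graph_K2)

theorem theorem1:
  shows "(\<forall>(G :: 'a ugraph) (H :: 'b ugraph).
            finite_simple_graph G \<longrightarrow> finite_simple_graph H \<longrightarrow>
            star_chromatic_index (G \<box> H)
              \<le> min (star_chromatic_index G * chromatic_number H + star_chromatic_index H)
                    (star_chromatic_index H * chromatic_number G + star_chromatic_index G))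
         \<and> (\<exists>(G :: nat ugraph) (H :: nat ugraph).
            finite_simple_graph G \<and> finite_simple_graph H \<and>
            edges G \<noteq> {} \<and> edges H \<noteq> {} \<and>
            star_chromatic_index (G \<box> H)
              = min (star_chromatic_index G * chromatic_number H + star_chromatic_index H)
                    (star_chromatic_index H * chromatic_number G + star_chromatic_index G))"
proof (intro conjI allI impI)
  fix G :: "'a ugraph" and H :: "'b ugraph"
  assume GH: "finite_simple_graph G" "finite_simple_graph H"
  show "star_chromatic_index (G \<box> H)
      \<le> min (star_chromatic_index G * chromatic_number H + star_chromatic_index H)
            (star_chromatic_index H * chromatic_number G + star_chromatic_index G)"
    using star_chromatic_index_cartesian_product_le[OF GH]
      star_chromatic_index_cartesian_product_commute_le[OF GH]
      star_chromatic_index_cartesian_product_le[OF GH(2,1)] by simp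
next
  have "star_chromatic_index K2 * chromatic_number K2 + star_chromatic_index K2 \<le> 1 * 2 + 1"
    by (intro add_mono mult_mono star_chromatic_index_K2_le chromatic_number_K2_le) simp_all
  \<comment> \<open>The general bound is at most \<open>1 * 2 + 1\<close>, while the 4-cycle needs
    at least three colors, so all these quantities equal 3.\<close>
  then have "star_chromatic_index (K2 \<box> K2)
      = star_chromatic_index K2 * chromatic_number K2 + star_chromatic_index K2"
    using star_chromatic_index_K2_box_K2_ge
      star_chromatic_index_cartesian_product_le[OF finite_simple_graph_K2 finite_simple_graph_K2]
    by simp
  then show "\<exists>(G :: nat ugraph) (H :: nat ugraph).
      finite_simple_graph G \<and> finite_simple_graph H \<and>
      edges G \<noteq> {} \<and> edges H \<noteq> {} \<and>
      star_chromatic_index (G \<box> H)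
        = min (star_chromatic_index G * chromatic_number H + star_chromatic_index H)
              (star_chromatic_index H * chromatic_number G + star_chromatic_index G)"
    \<comment> \<open>With both factors equal to \<open>K2\<close>, the two arguments of the minimum
      coincide.\<close>
    using finite_simple_graph_K2
    by (intro exI[of _ K2] conjI) (simp_all add: K2_def)
qed

end
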